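(* Let $\mathbf{M}$ be a mean such that $\sqrt{ab}\leq \mathbf{M}(a,b)$ for all $a,b>0$. If $A\in M_{2n}$ is positive definite, then $\mathrm{diag}_{\mathbf{M}}(A)\prec^{w}\delta(A)$.
   Context: $M_{m,n}$ is the set of $m\times n$ real matrices, $M_n=M_{n,n}$, $I_n$ is the identity matrix and $0_n$ the zero matrix of size $n$; $n\ge 1$ is an integer. Positive definite matrices are real symmetric positive definite. A (generalized) mean $\mathbf{M}$ is a positive continuous function on $(0,\infty)\times(0,\infty)$ such that for all $a,b>0$: (i) $\mathbf{M}(a,b)=\mathbf{M}(b,a)$; (ii) $\mathbf{M}(ra,rb)=r\mathbf{M}(a,b)$ for all $r>0$; (iii) $\mathbf{M}(a,b)$ is monotone increasing in $a$ and $b$; (iv) if $a\le b$, then $a\le \mathbf{M}(a,b)\le b$. For $A=[a_{ij}]_{i,j=1}^{2n}\in M_{2n}$ with all $a_{ii}>0$, the symplectic diagonal of $A$ associated with $\mathbf{M}$ is the vector $\mathrm{diag}_{\mathbf{M}}(A)=[\mathbf{M}(a_{ii},a_{n+i,n+i})]_{i=1}^n\in\mathbb{R}^n$. Let $J_{2n}=\begin{bmatrix}0_n & I_n\\ -I_n & 0_n\end{bmatrix}$. A matrix $W\in M_{2n}$ is symplectic if $W^\top J_{2n}W=J_{2n}$. By Williamson's theorem, every positive definite $A\in M_{2n}$ can be written as $A=W(D\oplus D)W^\top$ with $W$ symplectic and $D=\mathrm{diag}(\delta_1,\dots,\delta_n)$ a diagonal matrix with positive diagonal entries, unique up to permutation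 of its diagonal entries. The numbers $\delta_1,\dots,\delta_n$ (with multiplicity) are the symplectic eigenvalues of $A$, and $\delta(A)=[\delta_j^\uparrow]_{j=1}^n$ is the vector of symplectic eigenvalues in nondecreasing order. For real $z_1,\dots,z_n$, $z_1^\uparrow\le\cdots\le z_n^\uparrow$ denotes their nondecreasing rearrangement. For $x,y\in\mathbb{R}^n$, $x\prec^w y$ ($x$ is weakly supermajorized by $y$) means $\sum_{j=1}^k x_j^\uparrow\ge\sum_{j=1}^k y_j^\uparrow$ for all $k=1,\dots,n$. *)

theory Defs
  imports "HOL-Analysis.Product_Vector" "Jordan_Normal_Form.Matrix"
begin

text \<open>
  Vectors in \<open>\<real>\<^sup>n\<close> are lists of length \<open>n\<close>. Indices start at 0, so
  the entry written \<open>a\<^bsub>n+i,n+i\<^esub>\<close> with \<open>1 \<le> i \<le> n\<close> on paper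
  is \<open>A $$ (n + i, n + i)\<close> with \<open>i < n\<close> here.
\<close>

text \<open>The values of \<open>M\<close> outside \<open>(0,\<infinity>) \<times> (0,\<infinity>)\<close> are irrelevant.\<close>

definition generalized_mean :: "(real \<Rightarrow> real \<Rightarrow> real) \<Rightarrow> bool" where
  "generalized_mean M \<longleftrightarrow>
     continuous_on ({0<..} \<times> {0<..}) (\<lambda>(a, b). M a b) \<and>
     (\<forall>a>0. \<forall>b>0. M a b > 0) \<and>
     (\<forall>a>0. \<forall>b>0. M a b = M b a) \<and>
     (\<forall>a>0. \<forall>b>0. \<forall>r>0. M (r * a) (r * b) = r * M a b) \<and>
     (\<forall>b>0. mono_on {0<..} (\<lambda>a. M a b)) \<and>
     (\<forall>a>0. mono_on {0<..} (\<lambda>b. M a b)) \<and>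
     (\<forall>a>0. \<forall>b>0. a \<le> b \<longrightarrow> a \<le> M a b \<and> M a b \<le> b)"

definition positive_definite :: "nat \<Rightarrow> real mat \<Rightarrow> bool" where
  "positive_definite m A \<longleftrightarrow>
     A \<in> carrier_mat m m \<and> transpose_mat A = A \<and>
     (\<forall>v \<in> carrier_vec m. v \<noteq> 0\<^sub>v m \<longrightarrow> scalar_prod v (A *\<^sub>v v) > 0)"

definition symplectic_form_mat :: "nat \<Rightarrow> real mat" where
  "symplectic_form_mat n = four_block_mat (0\<^sub>m n n) (1\<^sub>m n) (- 1\<^sub>m n) (0\<^sub>m n n)"

definition symplectic_mat :: "nat \<Rightarrow> real mat \<Rightarrow> bool" where
  "symplectic_mat n W \<longleftrightarrow>
     W \<in> carrier_mat (2 * n) (2 * n) \<and>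
     transpose_mat W * symplectic_form_mat n * W = symplectic_form_mat n"

definition direct_sum_mat :: "real mat \<Rightarrow> real mat \<Rightarrow> real mat" where
  "direct_sum_mat A B =
     four_block_mat A (0\<^sub>m (dim_row A) (dim_col B)) (0\<^sub>m (dim_row B) (dim_col A)) B"

definition williamson_decomposition :: "nat \<Rightarrow> real mat \<Rightarrow> real mat \<Rightarrow> real list \<Rightarrow> bool" where
  "williamson_decomposition n A W ds \<longleftrightarrow>
     symplectic_mat n W \<and> length ds = n \<and> (\<forall>d \<in> set ds. d > 0) \<and>
     A = W * direct_sum_mat (mat_diag n (\<lambda>i. ds ! i)) (mat_diag n (\<lambda>i. ds ! i)) * transpose_mat W"

text \<open>
  For positive definite \<open>A\<close>, Williamson's theorem makes this description
  well-defined: a decomposition exists, and all of them give the same list after sorting.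
\<close>

definition symplectic_eigenvalues :: "nat \<Rightarrow> real mat \<Rightarrow> real list" where
  "symplectic_eigenvalues n A =
     (THE \<delta>. \<exists>W ds. williamson_decomposition n A W ds \<and> \<delta> = sort ds)"

definition symplectic_diag :: "(real \<Rightarrow> real \<Rightarrow> real) \<Rightarrow> nat \<Rightarrow> real mat \<Rightarrow> real list" where
  "symplectic_diag M n A = map (\<lambda>i. M (A $$ (i, i)) (A $$ (n + i, n + i))) [0..<n]"

definition weakly_supermajorized :: "real list \<Rightarrow> real list \<Rightarrow> bool" (infix "\<prec>\<^sup>w" 50) where
  "x \<prec>\<^sup>w y \<longleftrightarrow>
     length x = length y \<and>
     (\<forall>k \<in> {1..length x}. (\<Sum>j<k. sort x ! j) \<ge> (\<Sum>j<k. sort y ! j))"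

end

theory Submission
  imports Defs "Jordan_Normal_Form.Determinant" "HOL-Analysis.Function_Topology"
begin

text \<open>
  If \<open>A = W (D \<oplus> D) W\<^sup>T\<close>, then
  \<open>2 (\<delta>\<^sub>1 + \<dots> + \<delta>\<^sub>k)\<close>, with the \<open>\<delta>\<^sub>j\<close> in increasing order, is a lower bound for the trace of
  \<open>S\<^sup>T A S\<close> over all \<open>2n \<times> 2k\<close> matrices \<open>S\<close> with
  \<open>S\<^sup>T J S = J\<close>. The columns of the inverse transpose of a symplectic \<open>W\<close> attain it, so two
  Williamson decompositions of \<open>A\<close> bound each other and the symplectic eigenvalues are unique.
  Suitably scaled coordinate vectors as columns give the value
  \<open>2 \<Sum> sqrt (a\<^bsub>ii\<^esub> a\<^bsub>n+i,n+i\<^esub>)\<close>, which is at most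
  \<open>2 \<Sum> M a\<^bsub>ii\<^esub> a\<^bsub>n+i,n+i\<^esub>\<close>, and this is the claim.

  For the lower bound let \<open>u\<close> be a unit vector such that \<open>S u\<close> vanishes in \<open>m\<close> of the \<open>n\<close> modes.
  Then \<open>1 = \<omega> (u, J u) = \<omega> (S u, S J u)\<close> only involves the remaining modes, where it is at most half of
  \<open>|S u|\<^sup>2 + |S J u|\<^sup>2\<close>. Summing over an orthonormal family of \<open>2k - 2m\<close> such vectors
  and using Bessel's inequality bounds the squares of the entries of \<open>S\<close> in the remaining modes; summation
  by parts over the increasing \<open>\<delta>\<^sub>j\<close> does the rest.

  Williamson's theorem follows by taking \<open>T\<close> with \<open>\<langle>A T x, v\<rangle> = \<omega> (x, v)\<close> and successively maximizing
  \<open>\<langle>A T x, T x\<rangle> / \<langle>A x, x\<rangle>\<close> on the \<open>A\<close>-orthogonal complement of the pairs already found.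
\<close>

section \<open>Orthonormal families\<close>

text \<open>
  A vector in \<open>\<real>\<^sup>N\<close> is a function on \<open>nat\<close> whose values at indices from \<open>N\<close> on are ignored.
\<close>

definition dotp :: "nat \<Rightarrow> (nat \<Rightarrow> real) \<Rightarrow> (nat \<Rightarrow> real) \<Rightarrow> real" where
  "dotp N u v = (\<Sum>i<N. u i * v i)"

text \<open>This is \<open>u^T J v\<close> written out. Coordinates \<open>i\<close> and
  \<open>n + i\<close> are conjugate and together make up mode \<open>i\<close>.\<close>

definition symp :: "nat \<Rightarrow> (nat \<Rightarrow> real) \<Rightarrow> (nat \<Rightarrow> real) \<Rightarrow> real" where
  "symp n u v = (\<Sum>i<n. u i * v (n + i) - u (n + i) * v i)"

lemma sum_lessThan_double: "(\<Sum>i<2 * n. f i) = (\<Sum>i<n. f i + f (n + i))"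
  for f :: "nat \<Rightarrow> 'a::comm_monoid_add"
proof -
  have "(\<Sum>i<n + m. f i) = (\<Sum>i<n. f i) + (\<Sum>i<m. f (n + i))" for m
    by (induction m) (simp_all add: add.assoc)
  then show ?thesis by (simp add: mult_2 sum.distrib)
qed

lemma dotp_commute: "dotp N u v = dotp N v u"
  by (simp add: dotp_def mult.commute)

lemma dotp_self_nonneg: "0 \<le> dotp N u u"
  by (simp add: dotp_def sum_nonneg)

lemma dotp_self_eq_0_iff: "dotp N u u = 0 \<longleftrightarrow> (\<forall>i<N. u i = 0)"
  by (auto simp: dotp_def sum_nonneg_eq_0_iff)

lemma dotp_scale_right: "dotp N u (\<lambda>i. c * v i) = c * dotp N u v"
  by (simp add: dotp_def sum_distrib_left mult.left_commute)

lemma dotp_scale_left: "dotp N (\<lambda>i. c * u i) v = c * dotp N u v"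
  by (simp add: dotp_def sum_distrib_left mult.assoc)

text \<open>The vectors of \<open>C\<close>, padded with zero rows, form a square matrix whose last
  row is zero. Its transpose kills the last unit vector, so the determinant vanishes and the matrix
  has a nonzero kernel vector.\<close>

lemma exists_nonzero_orthogonal:
  assumes "finite C" "card C < N"
  shows "\<exists>u. dotp N u u \<noteq> 0 \<and> (\<forall>c\<in>C. dotp N c u = 0)"
proof -
  obtain c where c: "bij_betw c {..<card C} C"
    using ex_bij_betw_nat_finite[OF assms(1)] by (auto simp: atLeast0LessThan)
  define B where "B = mat N N (\<lambda>(i, j). if i < card C then c i j else 0)"
  have B: "B \<in> carrier_mat N N" by (simp add: B_def)
  have "B\<^sup>T *\<^sub>v unit_vec N (N - 1) = 0\<^sub>v N"
    using assms(2) by (intro eq_vecI) (auto simp: B_def)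
  moreover have "unit_vec N (N - 1) \<noteq> (0\<^sub>v N :: real vec)"
    using assms(2) by (intro unit_vec_nonzero) simp
  ultimately have "det B\<^sup>T = 0"
    unfolding det_0_iff_vec_prod_zero[OF transpose_carrier_mat[THEN iffD2, OF B]]
    by (intro exI[of _ "unit_vec N (N - 1)"] conjI unit_vec_carrier)
  then have "det B = 0" by (simp add: det_transpose[OF B])
  then obtain v where v: "v \<in> carrier_vec N" "v \<noteq> 0\<^sub>v N" "B *\<^sub>v v = 0\<^sub>v N"
    using det_0_iff_vec_prod_zero[OF B] by blast
  have "dotp N d (($) v) = 0" if "d \<in> C" for d
  proof -
    obtain i where i: "i < card C" "d = c i"
      using c \<open>d \<in> C\<close> unfolding bij_betw_def by blast
    then have "(B *\<^sub>v v) $ i = dotp N d (($) v)"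
      using v(1) assms(2) by (simp add: B_def dotp_def scalar_prod_def atLeast0LessThan)
    then show ?thesis using v(3) i assms(2) by simp
  qed
  moreover have "dotp N (($) v) (($) v) \<noteq> 0"
    using v by (auto simp: dotp_self_eq_0_iff intro!: eq_vecI)
  ultimately show ?thesis by blast
qed

definition orthonormal :: "nat \<Rightarrow> nat \<Rightarrow> (nat \<Rightarrow> nat \<Rightarrow> real) \<Rightarrow> bool" where
  "orthonormal N r u \<longleftrightarrow> (\<forall>a<r. \<forall>b<r. dotp N (u a) (u b) = of_bool (a = b))"

text \<open>Vectors already chosen are added to the constraints \<open>C\<close>, and the dimension
  count leaves room for one more, which is then normalized.\<close>

lemma exists_orthonormal_orthogonal:
  assumes "finite C" "card C + r \<le> N"
  shows "\<exists>u. orthonormal N r u \<and> (\<forall>a<r. \<forall>c\<in>C. dotp N c (u a) = 0)"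
  using assms(2)
proof (induction r)
  case 0
  then show ?case by (simp add: orthonormal_def)
next
  case (Suc r)
  then obtain u where u: "orthonormal N r u" "\<forall>a<r. \<forall>c\<in>C. dotp N c (u a) = 0" by auto
  have "card (C \<union> u ` {..<r}) < N"
    using card_Un_le[of C "u ` {..<r}"] card_image_le[of "{..<r}" u] Suc.prems by simp
  then obtain w where w: "dotp N w w \<noteq> 0" "\<forall>c\<in>C \<union> u ` {..<r}. dotp N c w = 0"
    using exists_nonzero_orthogonal[of "C \<union> u ` {..<r}" N] assms(1) by auto
  define w' where "w' = (\<lambda>i. (1 / sqrt (dotp N w w)) * w i)"
  have w'1: "dotp N w' w' = 1"
  proof -
    have "dotp N w' w' = dotp N w w / (sqrt (dotp N w w) * sqrt (dotp N w w))"
      unfolding w'_def dotp_scale_left dotp_scale_right by simp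
    then show ?thesis using w(1) dotp_self_nonneg[of N w] by simp
  qed
  have w'0: "dotp N c w' = 0" if "c \<in> C \<union> u ` {..<r}" for c
    using w(2) that unfolding w'_def dotp_scale_right by simp
  have "orthonormal N (Suc r) (u(r := w'))"
    unfolding orthonormal_def
  proof (intro allI impI)
    fix a b assume "a < Suc r" "b < Suc r"
    then show "dotp N ((u(r := w')) a) ((u(r := w')) b) = of_bool (a = b)"
      using u(1) w'1 w'0[of "u a"] w'0[of "u b"] dotp_commute[of N w' "u b"]
      by (cases "a = r"; cases "b = r") (auto simp: orthonormal_def)
  qed
  moreover have "\<forall>a<Suc r. \<forall>c\<in>C. dotp N c ((u(r := w')) a) = 0"
  proof (intro allI impI ballI)
    fix a c assume "a < Suc r" "c \<in> C"
    then show "dotp N c ((u(r := w')) a) = 0"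
      using u(2) w'0[of c] by (cases "a = r") auto
  qed
  ultimately show ?case by blast
qed

text \<open>With \<open>w\<close> the projection of \<open>v\<close> onto the span of the family,
  the square of \<open>v - w\<close> is the square of \<open>v\<close> minus the sum of squared
  coefficients.\<close>

lemma bessel_inequality:
  assumes "orthonormal N r u"
  shows "(\<Sum>a<r. (dotp N v (u a))\<^sup>2) \<le> dotp N v v"
proof -
  define c where "c a = dotp N v (u a)" for a
  define w where "w i = (\<Sum>a<r. c a * u a i)" for i
  have vw: "dotp N x w = (\<Sum>a<r. c a * dotp N x (u a))" for x
    unfolding dotp_def w_def sum_distrib_left
    by (subst sum.swap) (simp add: mult.left_commute)
  have uw: "dotp N (u b) w = c b" if "b < r" for b
  proof -
    have "dotp N (u b) w = (\<Sum>a<r. if a = b then c a else 0)"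
      unfolding vw using assms that
      by (intro sum.cong) (auto simp: orthonormal_def)
    then show ?thesis using that by simp
  qed
  have ww: "dotp N w w = (\<Sum>a<r. (c a)\<^sup>2)"
    unfolding vw[of w] by (intro sum.cong) (auto simp: uw dotp_commute[of N w "u _"] power2_eq_square)
  have "0 \<le> dotp N (\<lambda>i. v i - w i) (\<lambda>i. v i - w i)" by (rule dotp_self_nonneg)
  also have "\<dots> = dotp N v v - 2 * dotp N v w + dotp N w w"
    by (simp add: dotp_def algebra_simps sum.distrib sum_subtractf sum_distrib_left)
  also have "\<dots> = dotp N v v - (\<Sum>a<r. (c a)\<^sup>2)"
    unfolding ww by (simp add: vw c_def power2_eq_square)
  finally show ?thesis by (simp add: c_def)
qed

section \<open>The trace bound\<close>

text \<open>Multiplication by the transpose of \<open>J\<close>. With this sign, pairing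
  \<open>u\<close> with \<open>rot k u\<close> under \<open>symp\<close> gives the squared norm of
  \<open>u\<close>.\<close>

definition rot :: "nat \<Rightarrow> (nat \<Rightarrow> real) \<Rightarrow> nat \<Rightarrow> real" where
  "rot k u j = (if j < k then - u (k + j) else u (j - k))"

lemma symp_rot: "symp k u (rot k u) = dotp (2 * k) u u"
  by (simp add: symp_def rot_def dotp_def sum_lessThan_double)

lemma dotp_rot: "dotp (2 * k) (rot k u) (rot k v) = dotp (2 * k) u v"
  by (simp add: rot_def dotp_def sum_lessThan_double add.commute)

text \<open>\<open>S i\<close> is row \<open>i\<close> of a matrix whose columns form a symplectic
  frame. Vanishing in the \<open>m\<close> modes outside \<open>I\<close> costs at most
  \<open>2 * m\<close> of the \<open>2 * k\<close> dimensions. Each unit vector that remains needs,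
  together with its rotation, at least 2 units of mass in the modes of \<open>I\<close>; Bessel's
  inequality for the vectors and for their rotations counts the available mass twice.\<close>

lemma symplectic_frame_row_sum_bound:
  fixes S :: "nat \<Rightarrow> nat \<Rightarrow> real"
  assumes S: "\<And>u v. symp n (\<lambda>i. dotp (2 * k) (S i) u) (\<lambda>i. dotp (2 * k) (S i) v) = symp k u v"
    and I: "I \<subseteq> {..<n}"
  shows "2 * (real k + real (card I) - real n)
    \<le> (\<Sum>i\<in>I. dotp (2 * k) (S i) (S i) + dotp (2 * k) (S (n + i)) (S (n + i)))"
proof -
  define m where "m = card ({..<n} - I)"
  have fI: "finite I" using I finite_subset by blast
  have cI: "card I + m = n"
    using card_Diff_subset[OF fI I] card_mono[OF _ I] by (simp add: m_def)
  define R where "R x = (\<lambda>i. dotp (2 * k) (S i) x)" for x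
  show ?thesis
  proof (cases "m \<le> k")
    case False
    then have "2 * (real k + real (card I) - real n) \<le> 0" using cI by simp
    also have "0 \<le> (\<Sum>i\<in>I. dotp (2 * k) (S i) (S i) + dotp (2 * k) (S (n + i)) (S (n + i)))"
      by (intro sum_nonneg add_nonneg_nonneg dotp_self_nonneg)
    finally show ?thesis .
  next
    case True
    define r where "r = 2 * k - 2 * m"
    \<comment> \<open>Both rows of every omitted mode must annihilate the chosen vectors.\<close>
    define C where "C = S ` ({..<n} - I) \<union> (\<lambda>i. S (n + i)) ` ({..<n} - I)"
    have "card C \<le> m + m"
      unfolding C_def m_def
      by (rule order_trans[OF card_Un_le], rule add_mono; rule card_image_le) auto
    then have "card C + r \<le> 2 * k" using True by (simp add: r_def)
    moreover have "finite C" by (simp add: C_def)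
    ultimately obtain u where u: "orthonormal (2 * k) r u"
      "\<And>a c. a < r \<Longrightarrow> c \<in> C \<Longrightarrow> dotp (2 * k) c (u a) = 0"
      using exists_orthonormal_orthogonal[of C r "2 * k"] by auto
    define w where "w a = rot k (u a)" for a
    have w: "orthonormal (2 * k) r w"
      using u(1) by (simp add: orthonormal_def w_def dotp_rot)
    let ?p = "\<lambda>x i. (R x i)\<^sup>2 + (R x (n + i))\<^sup>2"
    have one: "2 \<le> (\<Sum>i\<in>I. ?p (u a) i + ?p (w a) i)" if a: "a < r" for a
    proof -
      have "symp k (u a) (w a) = 1"
        using u(1) a by (simp add: w_def symp_rot orthonormal_def)
      moreover have "symp k (u a) (w a) = (\<Sum>i<n. R (u a) i * R (w a) (n + i) - R (u a) (n + i) * R (w a) i)"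
        using S[of "u a" "w a"] by (simp add: symp_def R_def)
      \<comment> \<open>Each product contains an entry of \<open>R (u a)\<close>, so the modes
        outside \<open>I\<close> drop out although \<open>w a\<close> need not vanish there.\<close>
      moreover have "\<dots> = (\<Sum>i\<in>I. R (u a) i * R (w a) (n + i) - R (u a) (n + i) * R (w a) i)"
        using I a by (intro sum.mono_neutral_right) (auto simp: R_def u(2) C_def)
      moreover have "2 * \<dots> \<le> (\<Sum>i\<in>I. ?p (u a) i + ?p (w a) i)"
        unfolding sum_distrib_left
      proof (rule sum_mono)
        fix i
        have "0 \<le> (R (u a) i - R (w a) (n + i))\<^sup>2 + (R (u a) (n + i) + R (w a) i)\<^sup>2" by simp
        then show "2 * (R (u a) i * R (w a) (n + i) - R (u a) (n + i) * R (w a) i)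
            \<le> ?p (u a) i + ?p (w a) i"
          by (simp add: power2_eq_square algebra_simps)
      qed
      ultimately show ?thesis by linarith
    qed
    have bes: "(\<Sum>a<r. \<Sum>i\<in>I. ?p (x a) i)
      \<le> (\<Sum>i\<in>I. dotp (2 * k) (S i) (S i) + dotp (2 * k) (S (n + i)) (S (n + i)))"
      if "orthonormal (2 * k) r x" for x
    proof -
      have "(\<Sum>a<r. \<Sum>i\<in>I. ?p (x a) i) = (\<Sum>i\<in>I. \<Sum>a<r. ?p (x a) i)"
        by (rule sum.swap)
      also have "\<dots> \<le> (\<Sum>i\<in>I. dotp (2 * k) (S i) (S i) + dotp (2 * k) (S (n + i)) (S (n + i)))"
        unfolding sum.distrib R_def by (intro add_mono sum_mono bessel_inequality[OF that])
      finally show ?thesis .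
    qed
    have "2 * real r = (\<Sum>a<r. 2)" by simp
    also have "\<dots> \<le> (\<Sum>a<r. \<Sum>i\<in>I. ?p (u a) i + ?p (w a) i)"
      by (intro sum_mono) (use one in auto)
    also have "\<dots> = (\<Sum>a<r. \<Sum>i\<in>I. ?p (u a) i) + (\<Sum>a<r. \<Sum>i\<in>I. ?p (w a) i)"
      by (simp add: sum.distrib)
    finally have "real r
      \<le> (\<Sum>i\<in>I. dotp (2 * k) (S i) (S i) + dotp (2 * k) (S (n + i)) (S (n + i)))"
      using bes[OF u(1)] bes[OF w] by simp
    moreover have "real r = 2 * (real k + real (card I) - real n)"
      using True by (simp add: r_def cI[symmetric])
    ultimately show ?thesis by simp
  qed
qed

text \<open>Summation by parts. Lowering the weight \<open>d (Suc m)\<close> to \<open>d m\<close>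
  on a nonnegative tail decreases the product, so by induction \<open>d m\<close> times the tail
  from \<open>m\<close> is at most the weighted tail. The case \<open>m = 0\<close> is then
  nonnegative.\<close>

lemma sum_mult_nonneg_of_tails:
  fixes d c :: "nat \<Rightarrow> real"
  assumes d: "\<And>i. i < n \<Longrightarrow> 0 \<le> d i" "\<And>i j. i \<le> j \<Longrightarrow> j < n \<Longrightarrow> d i \<le> d j"
    and c: "\<And>m. m < n \<Longrightarrow> 0 \<le> (\<Sum>i=m..<n. c i)"
  shows "0 \<le> (\<Sum>i<n. d i * c i)"
proof -
  have "d m * (\<Sum>i=m..<n. c i) \<le> (\<Sum>i=m..<n. d i * c i)" if "m < n" for m
    using that
  proof (induction "n - m" arbitrary: m)
    case 0
    then show ?case by simp
  next
    case (Suc l)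
    show ?case
    proof (cases "Suc m < n")
      case True
      have "d m * (\<Sum>i=Suc m..<n. c i) \<le> d (Suc m) * (\<Sum>i=Suc m..<n. c i)"
        using d(2) c True by (intro mult_right_mono) auto
      also have "\<dots> \<le> (\<Sum>i=Suc m..<n. d i * c i)"
        using Suc True by (intro Suc.hyps(1)) auto
      finally show ?thesis
        using Suc.prems by (simp add: sum.atLeast_Suc_lessThan algebra_simps)
    next
      case False
      then have "{m..<n} = {m}" using Suc.prems by auto
      then show ?thesis by simp
    qed
  qed
  from this[of 0] c[of 0] d(1)[of 0] show ?thesis
    by (cases "n = 0") (auto simp: atLeast0LessThan intro: order_trans[OF mult_nonneg_nonneg])
qed

lemma sort_eq_permuted:
  obtains p where "bij_betw p {..<length xs} {..<length xs}"
    "\<And>j. j < length xs \<Longrightarrow> sort xs ! j = xs ! p j"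
proof -
  obtain p where p: "p permutes {..<length xs}" "permute_list p xs = sort xs"
    by (rule mset_eq_permutation[of "sort xs" xs]) auto
  show ?thesis
  proof
    show "bij_betw p {..<length xs} {..<length xs}" using p(1) by (rule permutes_imp_bij)
    show "sort xs ! j = xs ! p j" if "j < length xs" for j
      using permute_list_nth[OF p(1) that] p(2) by simp
  qed
qed

lemma symplectic_frame_trace_bound:
  fixes S :: "nat \<Rightarrow> nat \<Rightarrow> real"
  assumes S: "\<And>u v. symp n (\<lambda>i. dotp (2 * k) (S i) u) (\<lambda>i. dotp (2 * k) (S i) v) = symp k u v"
    and ds: "length ds = n" "\<forall>d\<in>set ds. 0 < d" and k: "k \<le> n"
  shows "2 * (\<Sum>j<k. sort ds ! j)
    \<le> (\<Sum>i<n. ds ! i * (dotp (2 * k) (S i) (S i) + dotp (2 * k) (S (n + i)) (S (n + i))))"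
proof -
  obtain p where p: "bij_betw p {..<n} {..<n}" "\<And>j. j < n \<Longrightarrow> sort ds ! j = ds ! p j"
    using sort_eq_permuted[of ds] ds(1) by auto
  let ?h = "\<lambda>i. dotp (2 * k) (S i) (S i) + dotp (2 * k) (S (n + i)) (S (n + i))"
  define c where "c i = ?h (p i) - 2 * of_bool (i < k)" for i
  have "0 \<le> (\<Sum>i<n. sort ds ! i * c i)"
  proof (rule sum_mult_nonneg_of_tails)
    show "0 \<le> sort ds ! i" if "i < n" for i
      using ds that by (metis length_sort less_imp_le nth_mem set_sort)
    show "sort ds ! i \<le> sort ds ! j" if "i \<le> j" "j < n" for i j
      using ds that by (intro sorted_nth_mono) auto
    show "0 \<le> (\<Sum>i=m..<n. c i)" if m: "m < n" for m
    proof -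
      have inj: "inj_on p {m..<n}"
        using p(1) by (auto simp: bij_betw_def intro: inj_on_subset)
      have sub: "p ` {m..<n} \<subseteq> {..<n}" using p(1) by (auto simp: bij_betw_def)
      have h: "(\<Sum>i=m..<n. ?h (p i)) = (\<Sum>i\<in>p ` {m..<n}. ?h i)"
        by (simp add: sum.reindex[OF inj])
      have b: "(\<Sum>i=m..<n. of_bool (i < k) :: real) = real (k - m)"
      proof -
        have "(\<Sum>i=m..<n. of_bool (i < k) :: real) = real (card ({m..<n} \<inter> {i. i < k}))"
          by simp
        also have "{m..<n} \<inter> {i. i < k} = {m..<k}" using k by auto
        finally show ?thesis by simp
      qed
      have "2 * (real k - real m) \<le> (\<Sum>i=m..<n. ?h (p i))"
        using symplectic_frame_row_sum_bound[OF S sub] m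
        by (simp add: h card_image[OF inj])
      \<comment> \<open>If \<open>m > k\<close>, the truncated difference \<open>k - m\<close> is 0
        and nonnegativity is what is needed.\<close>
      moreover have "0 \<le> (\<Sum>i=m..<n. ?h (p i))"
        by (intro sum_nonneg add_nonneg_nonneg dotp_self_nonneg)
      ultimately have "2 * real (k - m) \<le> (\<Sum>i=m..<n. ?h (p i))"
        by (cases "m \<le> k") auto
      then show ?thesis
        unfolding c_def sum_subtractf sum_distrib_left[symmetric] b by simp
    qed
  qed
  also have "(\<Sum>i<n. sort ds ! i * c i)
      = (\<Sum>i<n. sort ds ! i * ?h (p i)) - 2 * (\<Sum>i<n. sort ds ! i * of_bool (i < k))"
    unfolding c_def right_diff_distrib sum_subtractf sum_distrib_left
    by (simp add: mult.left_commute del: sum_mult_of_bool_eq)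
  also have "(\<Sum>i<n. sort ds ! i * of_bool (i < k)) = (\<Sum>i<k. sort ds ! i)"
    using k by (intro sum.mono_neutral_cong_right) auto
  also have "(\<Sum>i<n. sort ds ! i * ?h (p i)) = (\<Sum>i<n. ds ! p i * ?h (p i))"
    by (intro sum.cong) (auto simp: p(2))
  also have "\<dots> = (\<Sum>i<n. ds ! i * ?h i)"
    by (rule sum.reindex_bij_betw[OF p(1)])
  finally show ?thesis by simp
qed

section \<open>Williamson decompositions and symplectic families\<close>

definition mapp :: "nat \<Rightarrow> real mat \<Rightarrow> (nat \<Rightarrow> real) \<Rightarrow> nat \<Rightarrow> real" where
  "mapp N A v = (\<lambda>i. dotp N (\<lambda>j. A $$ (i, j)) v)"

definition form :: "nat \<Rightarrow> real mat \<Rightarrow> (nat \<Rightarrow> real) \<Rightarrow> (nat \<Rightarrow> real) \<Rightarrow> real" where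
  "form N A u v = dotp N u (mapp N A v)"

lemma form_alt: "form N A u v = (\<Sum>i<N. \<Sum>j<N. A $$ (i, j) * u i * v j)"
  by (simp add: form_def mapp_def dotp_def sum_distrib_left mult_ac)

lemma vec_mapp:
  assumes "S \<in> carrier_mat N m"
  shows "vec N (mapp m S u) = S *\<^sub>v vec m u"
  using assms by (intro eq_vecI) (auto simp: mapp_def dotp_def scalar_prod_def atLeast0LessThan)

lemma scalar_prod_vec: "vec N u \<bullet> vec N v = dotp N u v"
  by (simp add: dotp_def scalar_prod_def atLeast0LessThan)

lemma form_conv_scalar_prod:
  assumes "A \<in> carrier_mat N N"
  shows "form N A u v = vec N u \<bullet> (A *\<^sub>v vec N v)"
  by (simp add: form_def vec_mapp[OF assms, symmetric] scalar_prod_vec)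

lemma form_congruence:
  assumes M: "M \<in> carrier_mat N N" and S: "S \<in> carrier_mat N m"
  shows "form N M (mapp m S u) (mapp m S v) = form m (S\<^sup>T * M * S) u v"
proof -
  have "form N M (mapp m S u) (mapp m S v) = (S *\<^sub>v vec m u) \<bullet> (M *\<^sub>v (S *\<^sub>v vec m v))"
    by (simp add: form_conv_scalar_prod[OF M] vec_mapp[OF S])
  also have "\<dots> = vec m u \<bullet> (S\<^sup>T *\<^sub>v (M *\<^sub>v (S *\<^sub>v vec m v)))"
    using transpose_vec_mult_scalar[OF S, of "vec m u" "M *\<^sub>v (S *\<^sub>v vec m v)"] M S
    by (simp add: comm_scalar_prod[of _ N] comm_scalar_prod[of _ m])
  also have "S\<^sup>T *\<^sub>v (M *\<^sub>v (S *\<^sub>v vec m v)) = (S\<^sup>T * M * S) *\<^sub>v vec m v"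
    using M S by (simp add: assoc_mult_mat_vec[of _ m N _ N] assoc_mult_mat_vec[of _ m N _ m])
  finally show ?thesis using M S by (simp add: form_conv_scalar_prod)
qed

lemma index_congruence:
  assumes M: "M \<in> carrier_mat N N" and S: "S \<in> carrier_mat N m" and "i < m" "j < m"
  shows "(S\<^sup>T * M * S) $$ (i, j) = form N M (\<lambda>l. S $$ (l, i)) (\<lambda>l. S $$ (l, j))"
proof -
  have "(S\<^sup>T * M * S) $$ (i, j) = (S\<^sup>T * (M * S)) $$ (i, j)"
    using M S by (simp add: assoc_mult_mat[of _ m N _ N _ m])
  also have "\<dots> = form N M (\<lambda>l. S $$ (l, i)) (\<lambda>l. S $$ (l, j))"
    using assms by (simp add: form_def mapp_def dotp_def scalar_prod_def atLeast0LessThan)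
  finally show ?thesis .
qed

lemma symplectic_form_mat_carrier [simp]: "symplectic_form_mat n \<in> carrier_mat (2 * n) (2 * n)"
  by (simp add: symplectic_form_mat_def mult_2)

lemma index_symplectic_form_mat:
  assumes "i < 2 * n" "j < 2 * n"
  shows "symplectic_form_mat n $$ (i, j) = of_bool (j = n + i) - of_bool (i = n + j)"
  using assms by (auto simp: symplectic_form_mat_def)

lemma form_symplectic_form_mat: "form (2 * n) (symplectic_form_mat n) u v = symp n u v"
proof -
  have "form (2 * n) (symplectic_form_mat n) u v
      = (\<Sum>i<2*n. \<Sum>j<2*n. (of_bool (j = n + i) - of_bool (i = n + j)) * u i * v j)"
    unfolding form_alt by (intro sum.cong) (auto simp: index_symplectic_form_mat)
  also have "\<dots> = (\<Sum>i<n. (\<Sum>j<2*n. (of_bool (j = n + i) - of_bool (i = n + j)) * u i * v j)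
      + (\<Sum>j<2*n. (of_bool (j = n + (n + i)) - of_bool (n + i = n + j)) * u (n + i) * v j))"
    by (rule sum_lessThan_double)
  also have "\<dots> = symp n u v"
    unfolding symp_def
  proof (rule sum.cong[OF refl])
    fix i assume "i \<in> {..<n}"
    then have i: "i < n" by simp
    have "(\<Sum>j<2*n. (of_bool (j = n + i) - of_bool (i = n + j)) * u i * v j)
        = (\<Sum>j<2*n. if j = n + i then u i * v j else 0)"
      using i by (intro sum.cong) auto
    moreover have "(\<Sum>j<2*n. (of_bool (j = n + (n + i)) - of_bool (n + i = n + j)) * u (n + i) * v j)
        = (\<Sum>j<2*n. if j = i then - (u (n + i) * v j) else 0)"
      using i by (intro sum.cong) auto
    ultimately show "(\<Sum>j<2*n. (of_bool (j = n + i) - of_bool (i = n + j)) * u i * v j)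
      + (\<Sum>j<2*n. (of_bool (j = n + (n + i)) - of_bool (n + i = n + j)) * u (n + i) * v j)
      = u i * v (n + i) - u (n + i) * v i"
      using i by simp
  qed
  finally show ?thesis .
qed

section \<open>Double diagonal matrices and symplectic inverses\<close>

abbreviation double_diag :: "nat \<Rightarrow> real list \<Rightarrow> real mat" where
  "double_diag n ds \<equiv> direct_sum_mat (mat_diag n (\<lambda>i. ds ! i)) (mat_diag n (\<lambda>i. ds ! i))"

lemma double_diag_carrier [simp]: "double_diag n ds \<in> carrier_mat (2 * n) (2 * n)"
  by (simp add: direct_sum_mat_def mult_2 mat_diag_def)

lemma index_double_diag:
  assumes "i < 2 * n" "j < 2 * n"
  shows "double_diag n ds $$ (i, j) = (if i = j then ds ! (if i < n then i else i - n) else 0)"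
  using assms by (auto simp: direct_sum_mat_def mat_diag_def)

lemma form_double_diag:
  "form (2 * n) (double_diag n ds) u v = (\<Sum>i<n. ds ! i * (u i * v i + u (n + i) * v (n + i)))"
proof -
  have "form (2 * n) (double_diag n ds) u v
      = (\<Sum>i<2*n. \<Sum>j<2*n. if j = i then ds ! (if i < n then i else i - n) * u i * v j else 0)"
    unfolding form_alt by (intro sum.cong) (auto simp: index_double_diag)
  also have "\<dots> = (\<Sum>i<2*n. ds ! (if i < n then i else i - n) * u i * v i)" by simp
  finally show ?thesis by (simp only: sum_lessThan_double) (simp add: algebra_simps)
qed

lemma symplectic_form_mat_square:
  "symplectic_form_mat n * symplectic_form_mat n = - 1\<^sub>m (2 * n)"
proof -
  have "symplectic_form_mat n * symplectic_form_mat n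
      = four_block_mat (- 1\<^sub>m n) (0\<^sub>m n n) (0\<^sub>m n n) (- 1\<^sub>m n)"
    unfolding symplectic_form_mat_def by (subst mult_four_block_mat) auto
  also have "\<dots> = - 1\<^sub>m (2 * n)" by (intro eq_matI) auto
  finally show ?thesis .
qed

lemma transpose_symplectic_form_mat:
  "(symplectic_form_mat n)\<^sup>T = - symplectic_form_mat n"
  unfolding symplectic_form_mat_def by (subst transpose_four_block_mat) (auto intro!: eq_matI)

text \<open>Since \<open>J^2 = -I\<close>, the relation \<open>W^T J W = J\<close> makes
  \<open>-J W^T J\<close> a left inverse of \<open>W\<close>, hence a two-sided one, and
  \<open>S\<close> is its transpose. Inserting this inverse into \<open>W S^T = I\<close> yields
  \<open>W J W^T = J\<close>, from which \<open>S\<close> inherits the symplectic relation.\<close>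

lemma symplectic_inverse_transpose:
  assumes "symplectic_mat n W"
  obtains S where "symplectic_mat n S" "S\<^sup>T * W = 1\<^sub>m (2 * n)" "W * S\<^sup>T = 1\<^sub>m (2 * n)"
    "W\<^sup>T * S = 1\<^sub>m (2 * n)" "S * W\<^sup>T = 1\<^sub>m (2 * n)"
    "W * symplectic_form_mat n * W\<^sup>T = symplectic_form_mat n"
proof -
  define J where "J = symplectic_form_mat n"
  define I where "I = (1\<^sub>m (2 * n) :: real mat)"
  have J: "J \<in> carrier_mat (2 * n) (2 * n)" by (simp add: J_def)
  have W: "W \<in> carrier_mat (2 * n) (2 * n)" and WJW: "W\<^sup>T * J * W = J"
    using assms by (auto simp: symplectic_mat_def J_def)
  have JJ: "J * J = - I" by (simp add: J_def I_def symplectic_form_mat_square)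
  have WT: "W\<^sup>T \<in> carrier_mat (2 * n) (2 * n)" using W by simp
  note assoc = assoc_mult_mat[where ?n\<^sub>1 = "2*n" and ?n\<^sub>2 = "2*n" and ?n\<^sub>3 = "2*n" and ?n\<^sub>4 = "2*n"]
  define S where "S = - (J * W * J)"
  have S: "S \<in> carrier_mat (2 * n) (2 * n)" using J W by (auto simp: S_def)
  have ST: "S\<^sup>T = - (J * W\<^sup>T * J)"
  proof -
    have "(J * W * J)\<^sup>T = J\<^sup>T * (W\<^sup>T * J\<^sup>T)"
      using J W by (simp add: transpose_mult[of _ "2*n" "2*n" _ "2*n"])
    also have "\<dots> = - J * (W\<^sup>T * - J)"
      by (simp add: J_def transpose_symplectic_form_mat)
    also have "\<dots> = J * W\<^sup>T * J"
      using carrier_matD[OF J] J W WT by (simp add: assoc)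
    finally show ?thesis by (simp add: S_def transpose_uminus)
  qed
  have STc: "S\<^sup>T \<in> carrier_mat (2 * n) (2 * n)" using S by simp
  have "S\<^sup>T * W = - (J * (W\<^sup>T * J * W))"
    unfolding ST using J W WT by (simp add: assoc)
  also have "\<dots> = I" unfolding WJW JJ by (simp add: I_def)
  finally have 1: "S\<^sup>T * W = I" .
  then have 2: "W * S\<^sup>T = I" using mat_mult_left_right_inverse[OF STc W] by (simp add: I_def)
  have 3: "W\<^sup>T * S = I"
    using arg_cong[OF 1, of transpose_mat] S W by (simp add: transpose_mult[of _ "2*n" "2*n" _ "2*n"] I_def)
  have 4: "S * W\<^sup>T = I"
    using arg_cong[OF 2, of transpose_mat] S W by (simp add: transpose_mult[of _ "2*n" "2*n" _ "2*n"] I_def)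
  have "I * J = - (W * J * W\<^sup>T * J) * J"
    unfolding 2[symmetric] ST using J W WT by (simp add: assoc)
  also have "\<dots> = - (W * J * W\<^sup>T * (J * J))" using J W WT by (simp add: assoc)
  also have "\<dots> = W * J * W\<^sup>T" unfolding JJ I_def using J W WT by simp
  finally have 5: "W * J * W\<^sup>T = J" using J by (simp add: I_def)
  have "S\<^sup>T * J * S = S\<^sup>T * (W * J * W\<^sup>T) * S" by (simp add: 5)
  also have "\<dots> = (S\<^sup>T * W) * J * (W\<^sup>T * S)" using J W WT S STc by (simp add: assoc)
  also have "\<dots> = J" unfolding 1 3 using J by (simp add: I_def)
  finally have "symplectic_mat n S" using S by (simp add: symplectic_mat_def J_def)
  then show ?thesis using 1 2 3 4 5 by (intro that) (simp_all add: I_def J_def)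
qed

text \<open>Passing to \<open>R = W^T S\<close> turns the congruence of \<open>A\<close> into one of
  the double diagonal matrix, and the frame condition survives because \<open>W J W^T = J\<close>.
  The trace becomes the weighted row sum bounded before.\<close>

lemma williamson_trace_bound:
  assumes W: "williamson_decomposition n A W ds"
    and S: "S \<in> carrier_mat (2 * n) (2 * k)" and SJS: "S\<^sup>T * symplectic_form_mat n * S = symplectic_form_mat k"
    and k: "k \<le> n"
  shows "2 * (\<Sum>j<k. sort ds ! j) \<le> (\<Sum>j<2 * k. (S\<^sup>T * A * S) $$ (j, j))"
proof -
  define J where "J = symplectic_form_mat n"
  define D where "D = double_diag n ds"
  have J: "J \<in> carrier_mat (2 * n) (2 * n)" by (simp add: J_def)
  have D: "D \<in> carrier_mat (2 * n) (2 * n)" by (simp add: D_def)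
  have sW: "symplectic_mat n W" and ds: "length ds = n" "\<forall>d\<in>set ds. 0 < d"
    and A: "A = W * D * W\<^sup>T"
    using W by (auto simp: williamson_decomposition_def D_def)
  have Wc: "W \<in> carrier_mat (2 * n) (2 * n)" using sW by (simp add: symplectic_mat_def)
  have WJ: "W * J * W\<^sup>T = J"
    unfolding J_def using symplectic_inverse_transpose[OF sW] by metis
  define R where "R = W\<^sup>T * S"
  have R: "R \<in> carrier_mat (2 * n) (2 * k)" using Wc S by (simp add: R_def)
  have cong: "R\<^sup>T * X * R = S\<^sup>T * (W * X * W\<^sup>T) * S" if X: "X \<in> carrier_mat (2 * n) (2 * n)" for X
  proof -
    have RT: "R\<^sup>T = S\<^sup>T * W" using Wc S by (simp add: R_def transpose_mult[of _ "2*n" "2*n" _ "2*k"])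
    have c: "S\<^sup>T \<in> carrier_mat (2 * k) (2 * n)" "W\<^sup>T \<in> carrier_mat (2 * n) (2 * n)" using S Wc by auto
    show ?thesis
      unfolding RT unfolding R_def using c S X Wc
      by (simp add: assoc_mult_mat[of _ "2*k" "2*n" _ "2*n" _ "2*k"] assoc_mult_mat[of _ "2*k" "2*n" _ "2*n" _ "2*n"]
          assoc_mult_mat[of _ "2*n" "2*n" _ "2*n" _ "2*n"] assoc_mult_mat[of _ "2*n" "2*n" _ "2*n" _ "2*k"])
  qed
  have RJR: "R\<^sup>T * J * R = symplectic_form_mat k"
    using cong[OF J] SJS by (simp add: WJ) (simp add: J_def)
  have "symp n (mapp (2 * k) R u) (mapp (2 * k) R v) = symp k u v" for u v
    using form_congruence[OF J R, of u v] unfolding RJR by (simp add: J_def form_symplectic_form_mat)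
  then have "2 * (\<Sum>j<k. sort ds ! j) \<le> (\<Sum>i<n. ds ! i *
     (dotp (2 * k) (\<lambda>j. R $$ (i, j)) (\<lambda>j. R $$ (i, j)) + dotp (2 * k) (\<lambda>j. R $$ (n + i, j)) (\<lambda>j. R $$ (n + i, j))))"
    using symplectic_frame_trace_bound[where S = "\<lambda>i j. R $$ (i, j)" and n = n and k = k and ds = ds] ds k
    by (simp add: mapp_def)
  also have "\<dots> = (\<Sum>j<2 * k. form (2 * n) D (\<lambda>l. R $$ (l, j)) (\<lambda>l. R $$ (l, j)))"
    unfolding D_def form_double_diag dotp_def
    by (subst sum.swap) (simp add: sum_distrib_left sum.distrib distrib_left)
  also have "\<dots> = (\<Sum>j<2 * k. (R\<^sup>T * D * R) $$ (j, j))"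
    using index_congruence[OF D R] by (intro sum.cong) auto
  also have "R\<^sup>T * D * R = S\<^sup>T * A * S" using cong[OF D] by (simp add: A)
  finally show ?thesis .
qed

section \<open>Symplectic families of vectors\<close>

definition symplectic_family ::
  "nat \<Rightarrow> nat \<Rightarrow> (nat \<Rightarrow> nat \<Rightarrow> real) \<Rightarrow> (nat \<Rightarrow> nat \<Rightarrow> real) \<Rightarrow> bool" where
  "symplectic_family n k x y \<longleftrightarrow> (\<forall>a<k. \<forall>b<k. symp n (x a) (y b) = of_bool (a = b) \<and>
     symp n (x a) (x b) = 0 \<and> symp n (y a) (y b) = 0)"

text \<open>All \<open>x\<close> columns precede all \<open>y\<close> columns, to match the block
  order of \<open>symplectic_form_mat k\<close>.\<close>

definition family_mat ::
  "nat \<Rightarrow> nat \<Rightarrow> (nat \<Rightarrow> nat \<Rightarrow> real) \<Rightarrow> (nat \<Rightarrow> nat \<Rightarrow> real) \<Rightarrow> real mat" where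
  "family_mat n k x y = mat (2 * n) (2 * k) (\<lambda>(i, j). if j < k then x j i else y (j - k) i)"

lemma family_mat_carrier [simp]: "family_mat n k x y \<in> carrier_mat (2 * n) (2 * k)"
  by (simp add: family_mat_def)

lemma index_family_mat_congruence:
  assumes M: "M \<in> carrier_mat (2 * n) (2 * n)" and "i < 2 * k" "j < 2 * k"
  shows "((family_mat n k x y)\<^sup>T * M * family_mat n k x y) $$ (i, j) =
    form (2 * n) M (if i < k then x i else y (i - k)) (if j < k then x j else y (j - k))"
  unfolding index_congruence[OF M family_mat_carrier assms(2,3)] form_alt
  using assms(2,3) by (intro sum.cong) (auto simp: family_mat_def)

lemma symp_commute: "symp n u v = - symp n v u"
  by (simp add: symp_def sum_negf[symmetric] algebra_simps)

lemma family_mat_symplectic: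
  assumes "symplectic_family n k x y"
  shows "(family_mat n k x y)\<^sup>T * symplectic_form_mat n * family_mat n k x y = symplectic_form_mat k"
proof (rule eq_matI)
  have c: "symplectic_form_mat k \<in> carrier_mat (2 * k) (2 * k)" by simp
  fix i j assume "i < dim_row (symplectic_form_mat k)" "j < dim_col (symplectic_form_mat k)"
  then have ij: "i < 2 * k" "j < 2 * k" using c by (auto simp del: symplectic_form_mat_carrier)
  then show "((family_mat n k x y)\<^sup>T * symplectic_form_mat n * family_mat n k x y) $$ (i, j)
      = symplectic_form_mat k $$ (i, j)"
    using assms symp_commute[of n "y (i - k)" "x j"]
    by (auto simp: index_family_mat_congruence index_symplectic_form_mat form_symplectic_form_mat
        symplectic_family_def)
qed (auto simp: family_mat_def carrier_matD[OF symplectic_form_mat_carrier])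

text \<open>The trace bound with the family as columns of \<open>S\<close>. It serves twice:
  eigenvectors yield uniqueness of the symplectic eigenvalues, scaled coordinate vectors yield the
  final theorem.\<close>

lemma williamson_family_bound:
  assumes W: "williamson_decomposition n A W ds" and xy: "symplectic_family n k x y" and k: "k \<le> n"
  shows "2 * (\<Sum>j<k. sort ds ! j) \<le> (\<Sum>j<k. form (2 * n) A (x j) (x j) + form (2 * n) A (y j) (y j))"
proof -
  have A: "A \<in> carrier_mat (2 * n) (2 * n)"
    using W by (auto simp: williamson_decomposition_def symplectic_mat_def intro!: mult_carrier_mat)
  have "2 * (\<Sum>j<k. sort ds ! j) \<le>
      (\<Sum>j<2 * k. ((family_mat n k x y)\<^sup>T * A * family_mat n k x y) $$ (j, j))"
    by (rule williamson_trace_bound[OF W _ family_mat_symplectic[OF xy] k]) simp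
  also have "\<dots> = (\<Sum>j<k. form (2 * n) A (x j) (x j) + form (2 * n) A (y j) (y j))"
    unfolding sum_lessThan_double by (intro sum.cong) (auto simp: index_family_mat_congruence[OF A])
  finally show ?thesis .
qed

text \<open>The columns of the inverse transpose \<open>S\<close> of \<open>W\<close> work, because
  \<open>S^T A S\<close> cancels both factors \<open>W\<close> and leaves the double diagonal
  matrix.\<close>

lemma williamson_eigenfamily:
  assumes "williamson_decomposition n A W ds"
  obtains x y where "symplectic_family n n x y"
    "\<And>j. j < n \<Longrightarrow> form (2 * n) A (x j) (x j) = ds ! j"
    "\<And>j. j < n \<Longrightarrow> form (2 * n) A (y j) (y j) = ds ! j"
proof -
  define D where "D = double_diag n ds"
  have D: "D \<in> carrier_mat (2 * n) (2 * n)" by (simp add: D_def)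
  have sW: "symplectic_mat n W" and A: "A = W * D * W\<^sup>T"
    using assms by (auto simp: williamson_decomposition_def D_def)
  have W: "W \<in> carrier_mat (2 * n) (2 * n)" using sW by (simp add: symplectic_mat_def)
  have Ac: "A \<in> carrier_mat (2 * n) (2 * n)" using W D by (simp add: A)
  obtain S where sS: "symplectic_mat n S" and SW: "S\<^sup>T * W = 1\<^sub>m (2 * n)" "W\<^sup>T * S = 1\<^sub>m (2 * n)"
    using symplectic_inverse_transpose[OF sW] by metis
  have S: "S \<in> carrier_mat (2 * n) (2 * n)" and SJS: "S\<^sup>T * symplectic_form_mat n * S = symplectic_form_mat n"
    using sS by (auto simp: symplectic_mat_def)
  have "S\<^sup>T * A * S = (S\<^sup>T * W) * D * (W\<^sup>T * S)"
    using W S D by (simp add: A assoc_mult_mat[of _ "2*n" "2*n" _ "2*n" _ "2*n"])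
  then have SAS: "S\<^sup>T * A * S = D" unfolding SW using D by simp
  note iJ = index_congruence[OF symplectic_form_mat_carrier S, unfolded SJS form_symplectic_form_mat, symmetric]
  note iA = index_congruence[OF Ac S, unfolded SAS, symmetric]
  show ?thesis
  proof (rule that[of "\<lambda>j i. S $$ (i, j)" "\<lambda>j i. S $$ (i, n + j)"])
    show "symplectic_family n n (\<lambda>j i. S $$ (i, j)) (\<lambda>j i. S $$ (i, n + j))"
      unfolding symplectic_family_def by (auto simp: iJ index_symplectic_form_mat)
  qed (auto simp: iA D_def index_double_diag)
qed

section \<open>Uniqueness of the symplectic eigenvalues\<close>

lemma symplectic_family_comp:
  assumes "symplectic_family n n x y" "bij_betw p {..<n} {..<n}" "k \<le> n"
  shows "symplectic_family n k (\<lambda>j. x (p j)) (\<lambda>j. y (p j))"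
proof -
  have p: "p a < n" "p a = p b \<longleftrightarrow> a = b" if "a < k" "b < k" for a b
    using assms(2,3) that by (auto simp: bij_betw_def inj_on_def)
  show ?thesis
    using assms(1) p by (simp add: symplectic_family_def)
qed

text \<open>The bound from the first decomposition is tested on the eigenvectors of the second,
  taken in the order that sorts \<open>ds'\<close>. Exchanging the roles makes all partial sums
  agree.\<close>

lemma williamson_partial_sums_le:
  assumes "williamson_decomposition n A W ds" "williamson_decomposition n A W' ds'" "k \<le> n"
  shows "(\<Sum>j<k. sort ds ! j) \<le> (\<Sum>j<k. sort ds' ! j)"
proof -
  obtain x y where xy: "symplectic_family n n x y"
    "\<And>j. j < n \<Longrightarrow> form (2 * n) A (x j) (x j) = ds' ! j"
    "\<And>j. j < n \<Longrightarrow> form (2 * n) A (y j) (y j) = ds' ! j"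
    using williamson_eigenfamily[OF assms(2)] by blast
  have len: "length ds' = n" using assms(2) by (simp add: williamson_decomposition_def)
  obtain p where p: "bij_betw p {..<n} {..<n}" "\<And>j. j < n \<Longrightarrow> sort ds' ! j = ds' ! p j"
    using sort_eq_permuted[of ds'] len by auto
  have pn: "p j < n" if "j < n" for j using p(1) that by (auto simp: bij_betw_def)
  have "2 * (\<Sum>j<k. sort ds ! j)
      \<le> (\<Sum>j<k. form (2 * n) A (x (p j)) (x (p j)) + form (2 * n) A (y (p j)) (y (p j)))"
    by (rule williamson_family_bound[OF assms(1) symplectic_family_comp[OF xy(1) p(1) assms(3)] assms(3)])
  also have "\<dots> = (\<Sum>j<k. 2 * sort ds' ! j)"
    using assms(3) by (intro sum.cong) (auto simp: xy pn p(2))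
  finally show ?thesis by (simp add: sum_distrib_left[symmetric])
qed

lemma williamson_unique:
  assumes "williamson_decomposition n A W ds" "williamson_decomposition n A W' ds'"
  shows "sort ds = sort ds'"
proof (rule nth_equalityI)
  have len: "length ds = n" "length ds' = n"
    using assms by (auto simp: williamson_decomposition_def)
  then show "length (sort ds) = length (sort ds')" by simp
  have eq: "(\<Sum>j<k. sort ds ! j) = (\<Sum>j<k. sort ds' ! j)" if "k \<le> n" for k
    using williamson_partial_sums_le[OF assms that] williamson_partial_sums_le[OF assms(2,1) that]
    by simp
  fix i assume "i < length (sort ds)"
  then have "i < n" using len by simp
  then show "sort ds ! i = sort ds' ! i" using eq[of i] eq[of "Suc i"] by simp
qed

section \<open>Existence of a Williamson decomposition\<close>

lemma dotp_add_scale_left: "dotp N (\<lambda>i. u i + t * v i) w = dotp N u w + t * dotp N v w"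
  by (simp add: dotp_def algebra_simps sum.distrib sum_distrib_left)

lemma dotp_add_scale_right: "dotp N w (\<lambda>i. u i + t * v i) = dotp N w u + t * dotp N w v"
  by (simp add: dotp_def algebra_simps sum.distrib sum_distrib_left)

lemma mapp_add_scale: "mapp N A (\<lambda>i. u i + t * v i) = (\<lambda>i. mapp N A u i + t * mapp N A v i)"
  by (simp add: mapp_def dotp_add_scale_right)

lemma mapp_scale: "mapp N A (\<lambda>i. t * v i) = (\<lambda>i. t * mapp N A v i)"
  by (simp add: mapp_def dotp_scale_right)

lemmas form_linear = form_def mapp_add_scale mapp_scale dotp_add_scale_left dotp_add_scale_right
  dotp_scale_left dotp_scale_right

lemma form_add_scale_left: "form N A (\<lambda>i. u i + t * v i) w = form N A u w + t * form N A v w"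
  by (simp add: form_linear)

lemma form_add_scale_right: "form N A w (\<lambda>i. u i + t * v i) = form N A w u + t * form N A w v"
  by (simp add: form_linear)

lemma form_scale_left: "form N A (\<lambda>i. t * v i) w = t * form N A v w"
  by (simp add: form_linear)

lemma form_scale_right: "form N A w (\<lambda>i. t * v i) = t * form N A w v"
  by (simp add: form_linear)

lemma form_eq_0_left: "dotp N u u = 0 \<Longrightarrow> form N A u v = 0"
  by (simp add: dotp_self_eq_0_iff form_alt)

text \<open>Because the coordinates from \<open>N\<close> on are fixed at 0, the set is closed
  inside a product of compact intervals and singletons, which is compact by Tychonoff.\<close>

lemma compact_unit_sphere_subspace:
  "compact {x :: nat \<Rightarrow> real. (\<forall>i\<ge>N. x i = 0) \<and> dotp N x x = 1 \<and> (\<forall>c\<in>C. dotp N c x = 0)}"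
  (is "compact ?K")
proof -
  let ?B = "PiE UNIV (\<lambda>i::nat. if i < N then {-1..1::real} else {0})"
  have "compactin (product_topology (\<lambda>_. euclidean) UNIV) ?B"
    unfolding compactin_PiE by (auto simp: compactin_euclidean_iff)
  then have "compact ?B" by (simp only: euclidean_product_topology compactin_euclidean_iff)
  moreover have "closed ?K"
  proof -
    have cont: "continuous_on UNIV (\<lambda>x. dotp N (f x) (g x))"
      if "\<And>i. continuous_on UNIV (\<lambda>x. f x i)" "\<And>i. continuous_on UNIV (\<lambda>x. g x i)"
      for f g :: "(nat \<Rightarrow> real) \<Rightarrow> nat \<Rightarrow> real"
      unfolding dotp_def by (intro continuous_intros that)
    have "?K = (\<Inter>i\<in>{N..}. {x. x i = 0}) \<inter> {x. dotp N x x = 1} \<inter> (\<Inter>c\<in>C. {x. dotp N c x = 0})"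
      by auto
    also have "closed \<dots>"
      by (intro closed_Int closed_INT ballI closed_Collect_eq continuous_intros cont)
        (auto intro!: continuous_intros)
    finally show ?thesis .
  qed
  moreover have "?K \<subseteq> ?B"
  proof
    fix x assume x: "x \<in> ?K"
    have "\<bar>x i\<bar> \<le> 1" if "i < N" for i
    proof -
      have "x i * x i \<le> dotp N x x"
        unfolding dotp_def by (rule member_le_sum) (use that in auto)
      then have "(x i)\<^sup>2 \<le> 1" using x by (simp add: power2_eq_square)
      then show ?thesis by (simp add: abs_square_le_1)
    qed
    then have "x i \<in> (if i < N then {-1..1} else {0})" for i
      using x by (cases "i < N") (simp_all add: abs_le_iff minus_le_iff)
    then show "x \<in> ?B" unfolding PiE_UNIV_domain Pi_iff by blast
  qed
  ultimately show ?thesis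
    using compact_Int_closed[of ?B ?K] by (simp only: inf.absorb2)
qed

lemma linear_coefficient_eq_0:
  fixes b q :: real
  assumes "\<And>t. 0 \<le> 2 * t * b + t\<^sup>2 * q" "0 \<le> q"
  shows "b = 0"
proof (rule ccontr)
  assume "b \<noteq> 0"
  \<comment> \<open>The minimum of the quadratic is at \<open>- b / q\<close>; the denominator
    \<open>q + 1\<close> also covers \<open>q = 0\<close> and still gives a negative value.\<close>
  define r where "r = q + 1"
  have r: "r > 0" "q = r - 1" using assms(2) by (auto simp: r_def)
  have "2 * (- b / r) * b + (- b / r)\<^sup>2 * q = - (b\<^sup>2 * (r + 1) / r\<^sup>2)"
    unfolding r(2) using r(1) by (simp add: field_simps power2_eq_square)
  moreover have "0 < b\<^sup>2 * (r + 1) / r\<^sup>2" using \<open>b \<noteq> 0\<close> r(1) by simp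
  ultimately show False using assms(1)[of "- b / r"] by simp
qed

text \<open>The quotient of \<open>B\<close> by \<open>A\<close> attains its maximum
  \<open>M\<close> on the constrained unit sphere. There \<open>M * A - B\<close> is positive
  semidefinite on the constrained subspace and vanishes at the maximizer \<open>x\<close>, so its
  first variation at \<open>x\<close> is zero in every admissible direction.\<close>

lemma generalized_rayleigh_maximizer:
  assumes A: "\<And>u v. form N A u v = form N A v u" "\<And>u. dotp N u u \<noteq> 0 \<Longrightarrow> 0 < form N A u u"
    and B: "\<And>u v. form N B u v = form N B v u"
    and C: "finite C" "card C < N"
  shows "\<exists>x M. dotp N x x \<noteq> 0 \<and> (\<forall>c\<in>C. dotp N c x = 0) \<and>
    (\<forall>v. (\<forall>c\<in>C. dotp N c v = 0) \<longrightarrow> form N B x v = M * form N A x v)"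
proof -
  define K where "K = {x :: nat \<Rightarrow> real. (\<forall>i\<ge>N. x i = 0) \<and> dotp N x x = 1 \<and> (\<forall>c\<in>C. dotp N c x = 0)}"
  \<comment> \<open>Besides rescaling, this cuts \<open>w\<close> off at \<open>N\<close>, as
    membership in \<open>K\<close> demands; no form or inner product notices the cut.\<close>
  define nrm where "nrm w = (\<lambda>i. (1 / sqrt (dotp N w w)) * (if i < N then w i else 0))" for w
  have cut: "dotp N u (\<lambda>i. if i < N then w i else 0) = dotp N u w"
    "dotp N (\<lambda>i. if i < N then w i else 0) u = dotp N w u"
    "form N X (\<lambda>i. if i < N then w i else 0) (\<lambda>i. if i < N then w i else 0) = form N X w w" for u w X
    by (auto simp: dotp_def form_alt intro!: sum.cong)
  have form_nrm: "form N X (nrm w) (nrm w) = form N X w w / dotp N w w" for X w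
    unfolding nrm_def form_scale_left form_scale_right cut
    using dotp_self_nonneg[of N w] by simp
  have nrm: "nrm w \<in> K" if "dotp N w w \<noteq> 0" "\<forall>c\<in>C. dotp N c w = 0" for w
  proof -
    have "dotp N (nrm w) (nrm w) = 1"
      unfolding nrm_def dotp_scale_left dotp_scale_right cut
      using that(1) dotp_self_nonneg[of N w] by simp
    moreover have "dotp N c (nrm w) = 0" if "c \<in> C" for c
      using \<open>\<forall>c\<in>C. dotp N c w = 0\<close> that unfolding nrm_def dotp_scale_right cut by simp
    ultimately show ?thesis by (simp add: K_def) (simp add: nrm_def)
  qed
  have posK: "0 < form N A x x" if "x \<in> K" for x
    using A(2)[of x] that by (simp add: K_def)
  have cont: "continuous_on K (\<lambda>x. form N X x x)" for X
    unfolding form_alt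
    by (intro continuous_intros continuous_on_subset[OF continuous_on_product_coordinates]) auto
  have "K \<noteq> {}" using exists_nonzero_orthogonal[OF C] nrm by blast
  moreover have "compact K" unfolding K_def by (rule compact_unit_sphere_subspace)
  moreover have "continuous_on K (\<lambda>x. form N B x x / form N A x x)"
    using posK by (intro continuous_on_divide cont) (metis less_irrefl)
  ultimately obtain x where x: "x \<in> K"
    and max: "\<And>w. w \<in> K \<Longrightarrow> form N B w w / form N A w w \<le> form N B x x / form N A x x"
    using continuous_attains_sup[of K "\<lambda>x. form N B x x / form N A x x"] by blast
  define M where "M = form N B x x / form N A x x"
  have le: "form N B w w \<le> M * form N A w w" if w: "\<forall>c\<in>C. dotp N c w = 0" for w
  proof (cases "dotp N w w = 0")
    case True
    then show ?thesis by (simp add: form_eq_0_left)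
  next
    case False
    have "form N B w w / form N A w w \<le> M"
      using max[OF nrm[OF False w]] False by (simp add: form_nrm M_def)
    then show ?thesis using A(2)[OF False] by (simp add: pos_divide_le_eq)
  qed
  have "form N B x v = M * form N A x v" if v: "\<forall>c\<in>C. dotp N c v = 0" for v
  proof -
    have "M * form N A x v - form N B x v = 0"
    \<comment> \<open>\<open>q\<close> is the coefficient of \<open>t^2\<close> when
      \<open>M * A - B\<close> is expanded at \<open>x + t v\<close>; the constant term is zero by
      the choice of \<open>M\<close>.\<close>
    proof (rule linear_coefficient_eq_0[where q = "M * form N A v v - form N B v v"])
      fix t :: real
      have "\<forall>c\<in>C. dotp N c (\<lambda>i. x i + t * v i) = 0"
        using v x by (simp add: dotp_add_scale_right K_def)
      from le[OF this] have "0 \<le> M * form N A (\<lambda>i. x i + t * v i) (\<lambda>i. x i + t * v i)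
          - form N B (\<lambda>i. x i + t * v i) (\<lambda>i. x i + t * v i)" by simp
      also have "\<dots> = M * form N A x x - form N B x x
          + (2 * t * (M * form N A x v - form N B x v) + t\<^sup>2 * (M * form N A v v - form N B v v))"
        unfolding form_add_scale_left form_add_scale_right A(1)[of v x] B[of v x]
        by (simp add: algebra_simps power2_eq_square)
      also have "M * form N A x x - form N B x x = 0"
        using posK[OF x] by (simp add: M_def)
      finally show "0 \<le> 2 * t * (M * form N A x v - form N B x v)
        + t\<^sup>2 * (M * form N A v v - form N B v v)" by simp
    qed (use le[OF v] in simp)
    then show ?thesis by simp
  qed
  moreover have "dotp N x x \<noteq> 0" "\<forall>c\<in>C. dotp N c x = 0" using x by (auto simp: K_def)
  ultimately show ?thesis by blast
qed

section \<open>The symplectic form relative to a positive definite matrix\<close>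

lemma positive_definite_form:
  assumes "positive_definite N A"
  shows "form N A u v = form N A v u" "dotp N u u \<noteq> 0 \<Longrightarrow> 0 < form N A u u"
proof -
  have A: "A \<in> carrier_mat N N" "A\<^sup>T = A"
    and pos: "\<And>v. v \<in> carrier_vec N \<Longrightarrow> v \<noteq> 0\<^sub>v N \<Longrightarrow> 0 < v \<bullet> (A *\<^sub>v v)"
    using assms by (auto simp: positive_definite_def)
  have sym: "A $$ (i, j) = A $$ (j, i)" if "i < N" "j < N" for i j
    using A that by (metis carrier_matD index_transpose_mat(1))
  show "form N A u v = form N A v u"
    unfolding form_alt by (subst sum.swap) (auto intro!: sum.cong simp: sym)
  show "0 < form N A u u" if u: "dotp N u u \<noteq> 0"
  proof -
    have "vec N u \<noteq> 0\<^sub>v N"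
    proof
      assume "vec N u = 0\<^sub>v N"
      then have "u i = 0" if "i < N" for i using that by (metis index_vec index_zero_vec(1))
      then show False using u by (simp add: dotp_self_eq_0_iff)
    qed
    then show ?thesis using pos[of "vec N u"] by (simp add: form_conv_scalar_prod[OF A(1)])
  qed
qed

lemma positive_definite_inverse:
  assumes "positive_definite N A"
  obtains G where "G \<in> carrier_mat N N" "A * G = 1\<^sub>m N"
proof -
  have A: "A \<in> carrier_mat N N"
    and pos: "\<And>v. v \<in> carrier_vec N \<Longrightarrow> v \<noteq> 0\<^sub>v N \<Longrightarrow> 0 < v \<bullet> (A *\<^sub>v v)"
    using assms by (auto simp: positive_definite_def)
  have "det A \<noteq> 0"
  proof
    assume "det A = 0"
    then obtain v where v: "v \<in> carrier_vec N" "v \<noteq> 0\<^sub>v N" "A *\<^sub>v v = 0\<^sub>v N"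
      using det_0_iff_vec_prod_zero[OF A] by blast
    then show False using pos[of v] by simp
  qed
  then have "A \<in> Units (ring_mat TYPE(real) N ())" by (rule det_non_zero_imp_unit[OF A])
  then show ?thesis using that by (auto simp: Units_def ring_mat_def)
qed

text \<open>\<open>H = A^{-1} J^T\<close> represents the symplectic form in the inner product given
  by \<open>A\<close>; it is the operator \<open>T\<close> of the overview.\<close>

lemma symp_representation:
  assumes "positive_definite (2 * n) A"
  obtains H where "H \<in> carrier_mat (2 * n) (2 * n)"
    "\<And>x v. form (2 * n) A (mapp (2 * n) H x) v = symp n x v"
proof -
  let ?N = "2 * n" and ?J = "symplectic_form_mat n"
  have A: "A \<in> carrier_mat ?N ?N" using assms by (simp add: positive_definite_def)
  obtain G where G: "G \<in> carrier_mat ?N ?N" "A * G = 1\<^sub>m ?N"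
    using positive_definite_inverse[OF assms] .
  define H where "H = G * ?J\<^sup>T"
  have JT: "?J\<^sup>T \<in> carrier_mat ?N ?N" by simp
  have H: "H \<in> carrier_mat ?N ?N" using G(1) JT unfolding H_def by (rule mult_carrier_mat)
  have AH: "A * H = ?J\<^sup>T"
    using assoc_mult_mat[OF A G(1) JT] G(2) left_mult_one_mat[OF JT] by (simp add: H_def)
  have "form ?N A (mapp ?N H x) v = symp n x v" for x v
  proof -
    have "form ?N A (mapp ?N H x) v = form ?N A v (mapp ?N H x)"
      by (rule positive_definite_form(1)[OF assms])
    also have "\<dots> = vec ?N v \<bullet> (A *\<^sub>v (H *\<^sub>v vec ?N x))"
      by (simp add: form_conv_scalar_prod[OF A] vec_mapp[OF H])
    also have "A *\<^sub>v (H *\<^sub>v vec ?N x) = ?J\<^sup>T *\<^sub>v vec ?N x"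
      using assoc_mult_mat_vec[OF A H, of "vec ?N x"] by (simp add: AH)
    also have "vec ?N v \<bullet> (?J\<^sup>T *\<^sub>v vec ?N x) = (?J\<^sup>T *\<^sub>v vec ?N x) \<bullet> vec ?N v"
      by (rule comm_scalar_prod[of _ ?N]) (use mult_mat_vec_carrier[OF JT] in auto)
    also have "\<dots> = form ?N ?J x v"
      using transpose_vec_mult_scalar[OF symplectic_form_mat_carrier, of "vec ?N v" n "vec ?N x"]
      by (simp add: form_conv_scalar_prod)
    finally show ?thesis by (simp add: form_symplectic_form_mat)
  qed
  then show ?thesis using H that by blast
qed

section \<open>Splitting off invariant planes\<close>

lemma symp_self: "symp n x x = 0"
  by (simp add: symp_def)

text \<open>For positive definite \<open>A\<close>, the conditions over all \<open>v\<close> encode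
  \<open>T e = s f\<close> and \<open>T f = - s e\<close>, so each pair spans a
  \<open>T\<close>-invariant plane. The associated symplectic eigenvalue will be
  \<open>1 / s a\<close>.\<close>

definition normal_family ::
  "nat \<Rightarrow> real mat \<Rightarrow> nat \<Rightarrow> (nat \<Rightarrow> nat \<Rightarrow> real) \<Rightarrow> (nat \<Rightarrow> nat \<Rightarrow> real) \<Rightarrow> (nat \<Rightarrow> real) \<Rightarrow> bool" where
  "normal_family n A k e f s \<longleftrightarrow> (\<forall>a<k. 0 < s a \<and>
     (\<forall>v. symp n (e a) v = s a * form (2 * n) A (f a) v) \<and>
     (\<forall>v. symp n (f a) v = - s a * form (2 * n) A (e a) v) \<and>
     (\<forall>b<k. form (2 * n) A (e a) (e b) = of_bool (a = b) \<and>
        form (2 * n) A (f a) (f b) = of_bool (a = b) \<and> form (2 * n) A (e a) (f b) = 0))"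

text \<open>\<open>T\<close> is skew for the inner product of \<open>A\<close>, so it preserves the
  \<open>A\<close>-orthogonal complement of the pairs already found. A maximizer \<open>x\<close> of
  \<open>F (T x) (T x) / F x x\<close> there satisfies \<open>T (T x) = - M x\<close>, and
  \<open>x\<close> and \<open>T x\<close>, normalized, are the new pair.\<close>

lemma exists_normal_pair:
  assumes pd: "positive_definite (2 * n) A" and fam: "normal_family n A k e f s" and k: "k < n"
  obtains e' f' s' where "0 < s'"
    "\<And>v. symp n e' v = s' * form (2 * n) A f' v"
    "\<And>v. symp n f' v = - s' * form (2 * n) A e' v"
    "form (2 * n) A e' e' = 1" "form (2 * n) A f' f' = 1" "form (2 * n) A e' f' = 0"
    "\<And>a. a < k \<Longrightarrow> form (2 * n) A (e a) e' = 0" "\<And>a. a < k \<Longrightarrow> form (2 * n) A (f a) e' = 0"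
    "\<And>a. a < k \<Longrightarrow> form (2 * n) A (e a) f' = 0" "\<And>a. a < k \<Longrightarrow> form (2 * n) A (f a) f' = 0"
proof -
  define F where "F = form (2 * n) A"
  have sym: "F u v = F v u" for u v unfolding F_def by (rule positive_definite_form(1)[OF pd])
  have pos: "0 < F u u" if "dotp (2 * n) u u \<noteq> 0" for u
    unfolding F_def using that by (rule positive_definite_form(2)[OF pd])
  have A: "A \<in> carrier_mat (2 * n) (2 * n)" using pd by (simp add: positive_definite_def)
  obtain H where H: "H \<in> carrier_mat (2 * n) (2 * n)"
    and FT0: "\<And>x v. form (2 * n) A (mapp (2 * n) H x) v = symp n x v"
    using symp_representation[OF pd] by blast
  define T where "T = mapp (2 * n) H"
  have FT: "F (T x) v = symp n x v" for x v by (simp add: F_def T_def FT0)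
  define B where "B = H\<^sup>T * A * H"
  have FB: "form (2 * n) B u v = F (T u) (T v)" for u v
    unfolding B_def F_def T_def by (rule form_congruence[OF A H, symmetric])
  \<comment> \<open>Euclidean orthogonality to \<open>A e\<close> is \<open>A\<close>-orthogonality
    to \<open>e\<close>.\<close>
  define C where "C = (\<lambda>a. mapp (2 * n) A (e a)) ` {..<k} \<union> (\<lambda>a. mapp (2 * n) A (f a)) ` {..<k}"
  have CF: "(\<forall>c\<in>C. dotp (2 * n) c v = 0) \<longleftrightarrow> (\<forall>a<k. F (e a) v = 0 \<and> F (f a) v = 0)" for v
  proof -
    have "dotp (2 * n) (mapp (2 * n) A u) v = F u v" for u
      unfolding sym[of u v] by (simp add: F_def form_def dotp_commute)
    then show ?thesis by (simp add: C_def ball_Un) blast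
  qed
  have "card C \<le> card {..<k} + card {..<k}"
    unfolding C_def by (rule order_trans[OF card_Un_le], rule add_mono; rule card_image_le) auto
  then have "card C < 2 * n" using k by simp
  moreover have "finite C" by (simp add: C_def)
  ultimately obtain x M where x: "dotp (2 * n) x x \<noteq> 0" "\<forall>a<k. F (e a) x = 0 \<and> F (f a) x = 0"
    and ray: "\<And>v. \<forall>a<k. F (e a) v = 0 \<and> F (f a) v = 0 \<Longrightarrow> F (T x) (T v) = M * F x v"
    using generalized_rayleigh_maximizer[of "2 * n" A B C] sym pos
    unfolding F_def[symmetric] FB CF by metis
  have TV: "\<forall>a<k. F (e a) (T v) = 0 \<and> F (f a) (T v) = 0"
    if v: "\<forall>a<k. F (e a) v = 0 \<and> F (f a) v = 0" for v
  proof (intro allI impI conjI)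
    fix a assume a: "a < k"
    have "F (e a) (T v) = - symp n (e a) v" by (simp add: sym[of "e a"] FT symp_commute[of n v])
    then show "F (e a) (T v) = 0" using fam v a by (simp add: normal_family_def F_def)
    have "F (f a) (T v) = - symp n (f a) v" by (simp add: sym[of "f a"] FT symp_commute[of n v])
    then show "F (f a) (T v) = 0" using fam v a by (simp add: normal_family_def F_def)
  qed
  have ax: "0 < F x x" using pos[OF x(1)] .
  have "dotp (2 * n) (T x) (T x) \<noteq> 0"
  proof
    assume "dotp (2 * n) (T x) (T x) = 0"
    \<comment> \<open>Nondegeneracy of \<open>symp\<close>: pairing \<open>x\<close> with
      \<open>rot n x\<close> gives its squared norm.\<close>
    then have "F (T x) (rot n x) = 0" unfolding F_def by (rule form_eq_0_left)
    then show False using x(1) by (simp add: FT symp_rot)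
  qed
  then have "0 < F (T x) (T x)" by (rule pos)
  moreover have FTx: "F (T x) (T x) = M * F x x" by (rule ray[OF x(2)])
  ultimately have M: "0 < M" using ax by (simp add: zero_less_mult_iff)
  \<comment> \<open>The maximizer equation is known only for test vectors in the complement. Since
    \<open>w\<close> itself lies there, it can be tested against itself, which gives
    \<open>F w w = 0\<close> and hence \<open>T (T x) = - M x\<close> against every vector.\<close>
  define w where "w = (\<lambda>i. T (T x) i + M * x i)"
  have Fw: "F w v = F (T (T x)) v + M * F x v" for v
    unfolding w_def F_def by (rule form_add_scale_left)
  have wV: "\<forall>a<k. F (e a) w = 0 \<and> F (f a) w = 0"
    using x(2) TV[OF TV[OF x(2)]] by (simp add: sym[of _ w] Fw) (simp add: sym)
  have "F (T (T x)) w = - symp n w (T x)" by (simp add: FT symp_commute[of n "T x"])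
  also have "\<dots> = - F (T x) (T w)" unfolding FT[symmetric] by (simp add: sym[of "T w"])
  finally have "F w w = - F (T x) (T w) + M * F x w" by (simp add: Fw)
  then have "F w w = 0" using ray[OF wV] by simp
  then have w0: "dotp (2 * n) w w = 0" using pos[of w] by fastforce
  have T2: "symp n (T x) v = - M * F x v" for v
    using form_eq_0_left[OF w0, of A v] Fw[of v] by (simp add: F_def[symmetric] FT)
  \<comment> \<open>As \<open>F (T x) (T x) = M * \<alpha>\<close>, these two scalings normalize
    \<open>x\<close> and \<open>T x\<close>, and their ratio makes the new \<open>s'\<close> equal
    to \<open>sqrt M\<close>.\<close>
  define \<alpha> where "\<alpha> = F x x"
  define e' where "e' = (\<lambda>i. (1 / sqrt \<alpha>) * x i)"
  define f' where "f' = (\<lambda>i. (1 / sqrt (\<alpha> * M)) * T x i)"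
  have Fe: "F e' v = (1 / sqrt \<alpha>) * F x v" "F v e' = (1 / sqrt \<alpha>) * F v x" for v
    unfolding e'_def F_def by (rule form_scale_left form_scale_right)+
  have Ff: "F f' v = (1 / sqrt (\<alpha> * M)) * F (T x) v" "F v f' = (1 / sqrt (\<alpha> * M)) * F v (T x)" for v
    unfolding f'_def F_def by (rule form_scale_left form_scale_right)+
  have se: "symp n e' v = (1 / sqrt \<alpha>) * symp n x v" for v
    unfolding e'_def form_symplectic_form_mat[symmetric] by (rule form_scale_left)
  have sf: "symp n f' v = (1 / sqrt (\<alpha> * M)) * symp n (T x) v" for v
    unfolding f'_def form_symplectic_form_mat[symmetric] by (rule form_scale_left)
  have \<alpha>: "0 < \<alpha>" using ax by (simp add: \<alpha>_def)
  show ?thesis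
  proof (rule that[of "sqrt M" e' f'], unfold F_def[symmetric])
    show "0 < sqrt M" using M by simp
    show "symp n e' v = sqrt M * F f' v" for v
      using M by (simp add: se Ff FT real_sqrt_mult)
    show "symp n f' v = - sqrt M * F e' v" for v
      using M \<alpha> by (simp add: sf Fe T2 real_sqrt_mult field_simps)
    show "F e' e' = 1" using \<alpha> by (simp add: Fe \<alpha>_def[symmetric])
    show "F f' f' = 1" using \<alpha> M by (simp add: Ff FTx \<alpha>_def[symmetric] mult.commute)
    show "F e' f' = 0" by (simp add: Fe Ff sym[of x] FT symp_self)
    show "F (e a) e' = 0" "F (f a) e' = 0" "F (e a) f' = 0" "F (f a) f' = 0" if "a < k" for a
      using x(2) TV[OF x(2)] that by (simp_all add: Fe Ff)
  qed
qed

lemma exists_normal_family: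
  assumes pd: "positive_definite (2 * n) A" and "k \<le> n"
  shows "\<exists>e f s. normal_family n A k e f s"
  using assms(2)
proof (induction k)
  case 0
  then show ?case by (simp add: normal_family_def)
next
  case (Suc k)
  then obtain e f s where fam: "normal_family n A k e f s" by auto
  obtain s' e' f' where new: "0 < s'"
    "\<And>v. symp n e' v = s' * form (2 * n) A f' v"
    "\<And>v. symp n f' v = - s' * form (2 * n) A e' v"
    "form (2 * n) A e' e' = 1" "form (2 * n) A f' f' = 1" "form (2 * n) A e' f' = 0"
    "\<And>a. a < k \<Longrightarrow> form (2 * n) A (e a) e' = 0" "\<And>a. a < k \<Longrightarrow> form (2 * n) A (f a) e' = 0"
    "\<And>a. a < k \<Longrightarrow> form (2 * n) A (e a) f' = 0" "\<And>a. a < k \<Longrightarrow> form (2 * n) A (f a) f' = 0"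
    by (rule exists_normal_pair[OF pd fam Suc_le_lessD[OF Suc.prems]], rule that)
  note sym = positive_definite_form(1)[OF pd]
  have new': "form (2 * n) A e' (e a) = 0" "form (2 * n) A e' (f a) = 0"
    "form (2 * n) A f' (f a) = 0" if "a < k" for a
    using new(7-10)[OF that] by (simp_all add: sym[of e'] sym[of f'])
  have "normal_family n A (Suc k) (e(k := e')) (f(k := f')) (s(k := s'))"
    using fam new(1-6) new(7-10) new' unfolding normal_family_def less_Suc_eq
    by auto
  then show ?case by blast
qed

text \<open>In a full normal family \<open>symp n (e a) (f a) = s a\<close>, so dividing by
  \<open>sqrt (s a)\<close> makes the family symplectic and turns the values of the form of
  \<open>A\<close> into \<open>1 / s a\<close>. The resulting \<open>S\<close> diagonalizes
  \<open>A\<close> by congruence, and its inverse transpose is the required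
  \<open>W\<close>.\<close>

lemma williamson_exists:
  assumes pd: "positive_definite (2 * n) A"
  shows "\<exists>W ds. williamson_decomposition n A W ds"
proof -
  obtain e f s where fam: "normal_family n A n e f s" using exists_normal_family[OF pd order_refl] by blast
  define D where "D = double_diag n (map (\<lambda>j. 1 / s j) [0..<n])"
  define x where "x = (\<lambda>j i. (1 / sqrt (s j)) * e j i)"
  define y where "y = (\<lambda>j i. (1 / sqrt (s j)) * f j i)"
  have A: "A \<in> carrier_mat (2 * n) (2 * n)" using pd by (simp add: positive_definite_def)
  have D: "D \<in> carrier_mat (2 * n) (2 * n)" by (simp add: D_def)
  have s: "0 < s a" if "a < n" for a using fam that by (simp add: normal_family_def)
  have sabs: "\<bar>s a\<bar> = s a" "s a \<noteq> 0" if "a < n" for a using s[OF that] by auto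
  have symp_scale: "symp n (\<lambda>i. t * u i) (\<lambda>i. t' * v i) = t * t' * symp n u v" for t t' u v
    unfolding form_symplectic_form_mat[symmetric] form_scale_left form_scale_right by simp
  note sym = positive_definite_form(1)[OF pd]
  have sympxy: "symplectic_family n n x y"
    unfolding symplectic_family_def
  proof (intro allI impI conjI)
    fix a b assume ab: "a < n" "b < n"
    show "symp n (x a) (y b) = of_bool (a = b)"
      using fam ab by (auto simp: sabs x_def y_def symp_scale normal_family_def simp del: times_divide_eq_left) (simp add: sabs)
    show "symp n (x a) (x b) = 0"
      using fam ab by (simp add: x_def symp_scale normal_family_def sym[of "f a" "e b"] del: times_divide_eq_left)
    show "symp n (y a) (y b) = 0"
      using fam ab by (simp add: y_def symp_scale normal_family_def del: times_divide_eq_left)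
  qed
  define S where "S = family_mat n n x y"
  have S: "S \<in> carrier_mat (2 * n) (2 * n)" by (simp add: S_def)
  have SJS: "symplectic_mat n S"
    using family_mat_symplectic[OF sympxy] S by (simp add: symplectic_mat_def S_def)
  have SAS: "S\<^sup>T * A * S = D"
  proof (rule eq_matI)
    fix i j assume "i < dim_row D" "j < dim_col D"
    then have ij: "i < 2 * n" "j < 2 * n" using D by auto
    show "(S\<^sup>T * A * S) $$ (i, j) = D $$ (i, j)"
      unfolding S_def index_family_mat_congruence[OF A ij] D_def index_double_diag[OF ij]
      using fam ij
      by (auto simp: sabs x_def y_def form_scale_left form_scale_right normal_family_def sym[of "f _" "e _"]
          simp del: times_divide_eq_left)
  qed (use S A D in auto)
  obtain W where W: "symplectic_mat n W" "S * W\<^sup>T = 1\<^sub>m (2 * n)" "W * S\<^sup>T = 1\<^sub>m (2 * n)"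
    using symplectic_inverse_transpose[OF SJS] by metis
  have Wc: "W \<in> carrier_mat (2 * n) (2 * n)" using W(1) by (simp add: symplectic_mat_def)
  have "W * D * W\<^sup>T = (W * S\<^sup>T) * A * (S * W\<^sup>T)"
    unfolding SAS[symmetric] using Wc S A by (simp add: assoc_mult_mat[of _ "2*n" "2*n" _ "2*n" _ "2*n"])
  also have "\<dots> = A" unfolding W(2,3) using A by simp
  finally have "williamson_decomposition n A W (map (\<lambda>j. 1 / s j) [0..<n])"
    using W(1) s by (auto simp: williamson_decomposition_def D_def)
  then show ?thesis by blast
qed

section \<open>The symplectic diagonal\<close>

lemma symplectic_eigenvalues_eq:
  assumes "williamson_decomposition n A W ds"
  shows "symplectic_eigenvalues n A = sort ds"
  unfolding symplectic_eigenvalues_def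
  using assms by (intro the_equality) (auto dest: williamson_unique)

definition axis_vec :: "nat \<Rightarrow> real \<Rightarrow> nat \<Rightarrow> real" where
  "axis_vec j t = (\<lambda>i. if i = j then t else 0)"

lemma form_axis_vec:
  assumes "i < N" "j < N"
  shows "form N A (axis_vec i s) (axis_vec j t) = A $$ (i, j) * s * t"
proof -
  have right: "(\<Sum>b<N. c b * axis_vec j t b) = c j * t" for c
  proof -
    have "(\<Sum>b<N. c b * axis_vec j t b) = (\<Sum>b<N. if b = j then c j * t else 0)"
      by (intro sum.cong) (auto simp: axis_vec_def)
    then show ?thesis using assms(2) by simp
  qed
  have "form N A (axis_vec i s) (axis_vec j t) = (\<Sum>a<N. if a = i then A $$ (i, j) * s * t else 0)"
    unfolding form_alt right by (intro sum.cong) (auto simp: axis_vec_def)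
  then show ?thesis using assms(1) by simp
qed

lemma symp_axis_vec:
  assumes "i < 2 * n" "j < 2 * n"
  shows "symp n (axis_vec i s) (axis_vec j t) = (of_bool (j = n + i) - of_bool (i = n + j)) * s * t"
  using form_axis_vec[OF assms, of "symplectic_form_mat n"] assms
  by (simp add: form_symplectic_form_mat index_symplectic_form_mat)

lemma positive_definite_diag_pos:
  assumes "positive_definite N A" "i < N"
  shows "0 < A $$ (i, i)"
proof -
  have "dotp N (axis_vec i 1) (axis_vec i 1) \<noteq> 0"
    using assms(2) by (auto simp: dotp_self_eq_0_iff axis_vec_def)
  then show ?thesis
    using positive_definite_form(2)[OF assms(1)] form_axis_vec[OF assms(2,2), of A 1 1] by fastforce
qed

text \<open>The scaling \<open>t = (b / a)\<^bsup>1/4\<^esup>\<close> makes both \<open>t\<^sup>2 a\<close> and \<open>b / t\<^sup>2\<close> equal to \<open>sqrt (a b)\<close>.\<close>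

lemma symplectic_axis_family:
  assumes pd: "positive_definite (2 * n) A"
  obtains x y where "symplectic_family n n x y"
    "\<And>j. j < n \<Longrightarrow> form (2 * n) A (x j) (x j) = sqrt (A $$ (j, j) * A $$ (n + j, n + j))"
    "\<And>j. j < n \<Longrightarrow> form (2 * n) A (y j) (y j) = sqrt (A $$ (j, j) * A $$ (n + j, n + j))"
proof -
  define t where "t j = sqrt (sqrt (A $$ (n + j, n + j) / A $$ (j, j)))" for j
  have pos: "0 < A $$ (j, j)" "0 < A $$ (n + j, n + j)" if "j < n" for j
    using positive_definite_diag_pos[OF pd] that by auto
  have t: "0 < t j" if "j < n" for j using pos[OF that] by (simp add: t_def)
  have tt: "t j * t j = sqrt (A $$ (n + j, n + j)) / sqrt (A $$ (j, j))" if "j < n" for j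
    using pos[OF that] by (simp add: t_def real_sqrt_divide)
  show ?thesis
  proof (rule that[of "\<lambda>j. axis_vec j (t j)" "\<lambda>j. axis_vec (n + j) (1 / t j)"])
    show "symplectic_family n n (\<lambda>j. axis_vec j (t j)) (\<lambda>j. axis_vec (n + j) (1 / t j))"
      unfolding symplectic_family_def
    proof (intro allI impI)
      fix a b assume "a < n" "b < n"
      then show "symp n (axis_vec a (t a)) (axis_vec (n + b) (1 / t b)) = of_bool (a = b) \<and>
        symp n (axis_vec a (t a)) (axis_vec b (t b)) = 0 \<and>
        symp n (axis_vec (n + a) (1 / t a)) (axis_vec (n + b) (1 / t b)) = 0"
        using t[of a] by (auto simp: symp_axis_vec)
    qed
  next
    fix j assume j: "j < n"
    let ?a = "sqrt (A $$ (j, j))" and ?b = "sqrt (A $$ (n + j, n + j))"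
    have ab: "0 < ?a" "0 < ?b" using pos[OF j] by simp_all
    have cancel: "p * p * (q / p) = p * q" "q * q / (q / p) = p * q" if "0 < p" "0 < q" for p q :: real
      using that by (simp_all add: field_simps)
    have "form (2 * n) A (axis_vec j (t j)) (axis_vec j (t j)) = ?a * ?a * (t j * t j)"
      using j pos[OF j] by (simp add: form_axis_vec)
    also have "\<dots> = ?a * ?b" unfolding tt[OF j] by (rule cancel[OF ab])
    finally show "form (2 * n) A (axis_vec j (t j)) (axis_vec j (t j))
      = sqrt (A $$ (j, j) * A $$ (n + j, n + j))" by (simp only: real_sqrt_mult)
    have "form (2 * n) A (axis_vec (n + j) (1 / t j)) (axis_vec (n + j) (1 / t j)) = ?b * ?b / (t j * t j)"
      using j pos[OF j] by (simp add: form_axis_vec)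
    also have "\<dots> = ?a * ?b" unfolding tt[OF j] by (rule cancel[OF ab])
    finally show "form (2 * n) A (axis_vec (n + j) (1 / t j)) (axis_vec (n + j) (1 / t j))
      = sqrt (A $$ (j, j) * A $$ (n + j, n + j))" by (simp only: real_sqrt_mult)
  qed
qed

theorem theorem4p1:
  fixes M :: "real \<Rightarrow> real \<Rightarrow> real" and n :: nat and A :: "real mat"
  assumes "n \<ge> 1"
    and "generalized_mean M"
    and "\<And>a b. a > 0 \<Longrightarrow> b > 0 \<Longrightarrow> sqrt (a * b) \<le> M a b"
    and "positive_definite (2 * n) A"
  shows "symplectic_diag M n A \<prec>\<^sup>w symplectic_eigenvalues n A"
proof -
  obtain W ds where W: "williamson_decomposition n A W ds"
    using williamson_exists[OF assms(4)] by blast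
  define g where "g j = sqrt (A $$ (j, j) * A $$ (n + j, n + j))" for j
  obtain x y where xy: "symplectic_family n n x y"
    "\<And>j. j < n \<Longrightarrow> form (2 * n) A (x j) (x j) = g j"
    "\<And>j. j < n \<Longrightarrow> form (2 * n) A (y j) (y j) = g j"
    unfolding g_def using symplectic_axis_family[OF assms(4)] by blast
  let ?m = "symplectic_diag M n A"
  have len: "length ?m = n" "length ds = n"
    using W by (auto simp: symplectic_diag_def williamson_decomposition_def)
  \<comment> \<open>The geometric mean bound on \<open>M\<close> enters here, entry by
    entry.\<close>
  have m: "g j \<le> ?m ! j" if "j < n" for j
    using assms(3) positive_definite_diag_pos[OF assms(4)] that by (simp add: symplectic_diag_def g_def)
  \<comment> \<open>The coordinate pairs are ordered by the entries of the symplectic diagonal, so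
    the first \<open>k\<close> pairs belong to its \<open>k\<close> smallest entries.\<close>
  obtain p where p: "bij_betw p {..<n} {..<n}" "\<And>j. j < n \<Longrightarrow> sort ?m ! j = ?m ! p j"
    using sort_eq_permuted[of ?m] len by auto
  have pn: "p j < n" if "j < n" for j using p(1) that by (auto simp: bij_betw_def)
  have "(\<Sum>j<k. sort ds ! j) \<le> (\<Sum>j<k. sort ?m ! j)" if k: "k \<le> n" for k
  proof -
    have "2 * (\<Sum>j<k. sort ds ! j)
        \<le> (\<Sum>j<k. form (2 * n) A (x (p j)) (x (p j)) + form (2 * n) A (y (p j)) (y (p j)))"
      by (rule williamson_family_bound[OF W symplectic_family_comp[OF xy(1) p(1) k] k])
    also have "\<dots> = (\<Sum>j<k. 2 * g (p j))"
      using k by (intro sum.cong) (auto simp: xy pn)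
    also have "\<dots> \<le> (\<Sum>j<k. 2 * sort ?m ! j)"
      using k by (intro sum_mono) (auto simp: p(2) intro!: m pn)
    finally show ?thesis by (simp add: sum_distrib_left[symmetric])
  qed
  then show ?thesis
    using len by (auto simp: weakly_supermajorized_def symplectic_eigenvalues_eq[OF W] sorted_sort_id)
qed

end
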